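(* Let $(X,\|\cdot\|)$ be a Banach space and let $K$ be a compact convex subset of $X$ containing the null vector $\theta$. Let $T: K \to K$ be a perimetric nonexpansive mapping with no periodic point of prime period $2$. Then $T$ has a fixed point in $K$.
   Context: For a subset $K$ of a normed linear space $(X,\|\cdot\|)$, a mapping $T: K \to K$ is called a perimetric nonexpansive mapping if for all pairwise distinct points $x,y,z \in K$, $$\|Tx-Ty\| + \|Ty-Tz\| + \|Tz-Tx\| \le \|x-y\| + \|y-z\| + \|z-x\|.$$ A point $x \in K$ is a periodic point of $T$ of prime period $2$ if $T^2x = x$ and $Tx \neq x$. A fixed point of $T$ is a point $x$ with $Tx = x$. The null vector $\theta$ is the zero vector of $X$. *)

theory Defs
  imports "HOL-Analysis.Analysis"
begin

definition perimetric_nonexpansive_on ::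
    "'a::real_normed_vector set \<Rightarrow> ('a \<Rightarrow> 'a) \<Rightarrow> bool" where
  "perimetric_nonexpansive_on K T \<longleftrightarrow>
     T \<in> K \<rightarrow> K \<and>
     (\<forall>x\<in>K. \<forall>y\<in>K. \<forall>z\<in>K. x \<noteq> y \<and> y \<noteq> z \<and> z \<noteq> x \<longrightarrow>
        norm (T x - T y) + norm (T y - T z) + norm (T z - T x)
          \<le> norm (x - y) + norm (y - z) + norm (z - x))"

definition periodic_point_prime_period_2 ::
    "'a set \<Rightarrow> ('a \<Rightarrow> 'a) \<Rightarrow> 'a \<Rightarrow> bool" where
  "periodic_point_prime_period_2 K T x \<longleftrightarrow> x \<in> K \<and> (T ^^ 2) x = x \<and> T x \<noteq> x"

end

theory Submission
  imports Defs
begin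

text \<open>
  On a convex set a perimetric nonexpansive map is nonexpansive: the degenerate triangle formed
  by \<open>x\<close>, \<open>y\<close> and their midpoint has perimeter \<open>2 * norm (x - y)\<close>, while the perimeter of its
  image is at least \<open>2 * norm (T x - T y)\<close>. The contractions \<open>c T\<close> with \<open>c < 1\<close> have fixed points
  by Banach's theorem, and these satisfy \<open>norm (T x - x) = (1 - c) * norm (T x)\<close>. So the minimum
  of \<open>norm (T x - x)\<close> over the compact set \<open>K\<close> is \<open>0\<close>.
\<close>

lemma perimetric_nonexpansive_on_imp_nonexpansive:
  fixes K :: "'a::real_normed_vector set"
  assumes "perimetric_nonexpansive_on K T" "convex K" "x \<in> K" "y \<in> K"
  shows "norm (T x - T y) \<le> norm (x - y)"
proof (cases "x = y")
  case False
  define z where "z = midpoint x y"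
  have z: "z \<in> K"
    using assms closed_segment_subset[of x K y] midpoint_in_closed_segment[of x y]
    by (auto simp: z_def)
  \<comment> \<open>The perimeter condition speaks only of pairwise distinct points, so the midpoint
    must differ from both endpoints.\<close>
  have "x \<noteq> z" "z \<noteq> y"
    using False midpoint_eq_endpoint[of x y] unfolding z_def by metis+
  then have "norm (T x - T y) + norm (T y - T z) + norm (T z - T x)
      \<le> norm (x - y) + norm (y - z) + norm (z - x)"
    using assms False z unfolding perimetric_nonexpansive_on_def by metis
  moreover have "norm (y - z) + norm (z - x) = norm (x - y)"
    by (simp add: z_def dist_midpoint flip: dist_norm)
  moreover have "norm (T x - T y) \<le> norm (T y - T z) + norm (T z - T x)"
    using norm_triangle_ineq[of "T y - T z" "T z - T x"] by (simp add: norm_minus_commute)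
  ultimately show ?thesis by linarith
qed simp

lemma nonexpansive_compact_convex_fixed_point:
  fixes K :: "'a::real_normed_vector set"
  assumes "compact K" "convex K" "0 \<in> K" "T \<in> K \<rightarrow> K"
    and nonexp: "\<And>x y. x \<in> K \<Longrightarrow> y \<in> K \<Longrightarrow> norm (T x - T y) \<le> norm (x - y)"
  shows "\<exists>x\<in>K. T x = x"
proof -
  have "continuous_on K T"
    using nonexp by (intro lipschitz_on_continuous_on[of 1] lipschitz_onI) (auto simp: dist_norm)
  then have "continuous_on K (\<lambda>x. norm (T x - x))"
    by (intro continuous_intros)
  then obtain p where p: "p \<in> K" and min: "\<And>x. x \<in> K \<Longrightarrow> norm (T p - p) \<le> norm (T x - x)"
    using continuous_attains_inf[of K "\<lambda>x. norm (T x - x)"] assms by blast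
  obtain B where B: "\<And>x. x \<in> K \<Longrightarrow> norm x \<le> B"
    using compact_imp_bounded[OF \<open>compact K\<close>] by (auto simp: bounded_iff)
  \<comment> \<open>\<open>p\<close> and \<open>B\<close> are fixed before \<open>c\<close>, so this
    bound survives letting \<open>c\<close> tend to 1.\<close>
  have "norm (T p - p) \<le> (1 - c) * B" if c: "0 \<le> c" "c < 1" for c
  proof -
    have "\<exists>!x\<in>K. c *\<^sub>R T x = x"
    proof (rule Banach_fix)
      \<comment> \<open>\<open>c *\<^sub>R T x\<close> is a convex combination of \<open>0\<close>
        and \<open>T x\<close>, both in \<open>K\<close>.\<close>
      show "(\<lambda>x. c *\<^sub>R T x) ` K \<subseteq> K"
        using assms c convexD_alt[of K 0 _ c] by fastforce
      show "dist (c *\<^sub>R T x) (c *\<^sub>R T y) \<le> c * dist x y" if "x \<in> K" "y \<in> K" for x y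
        using nonexp that c
        by (simp add: dist_norm mult_left_mono flip: scaleR_diff_right)
    qed (use assms c compact_imp_complete in auto)
    then obtain x where x: "x \<in> K" "c *\<^sub>R T x = x" by blast
    have "T x - x = (1 - c) *\<^sub>R T x"
      using x(2) by (simp add: scaleR_diff_left)
    then have "norm (T x - x) \<le> (1 - c) * B"
      using B[of "T x"] c x(1) \<open>T \<in> K \<rightarrow> K\<close> by (auto intro: mult_left_mono)
    then show ?thesis
      using min[OF x(1)] by linarith
  qed
  \<comment> \<open>The bound is available for \<open>c\<close> in [0, 1), a left neighbourhood of
    1, hence the one-sided limit. It forces the minimal displacement to be at most 0.\<close>
  moreover have "((\<lambda>c. (1 - c) * B) \<longlongrightarrow> (1 - 1) * B) (at_left 1)"
    by (intro tendsto_intros)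
  moreover have "\<forall>\<^sub>F c in at_left 1. 0 \<le> c \<and> c < (1::real)"
    using eventually_at_left_real[of 0 "1::real"] by (auto elim: eventually_mono)
  ultimately have "norm (T p - p) \<le> (1 - 1) * B"
    by (intro tendsto_lowerbound[where F = "at_left (1::real)"]) (auto elim: eventually_mono)
  with p show ?thesis by auto
qed

theorem theorem3p3:
  fixes K :: "'a::banach set" and T :: "'a \<Rightarrow> 'a"
  assumes "compact K" and "convex K" and "0 \<in> K"
    and "perimetric_nonexpansive_on K T"
    and "\<not> (\<exists>x. periodic_point_prime_period_2 K T x)"
  shows "\<exists>x\<in>K. T x = x"
proof (rule nonexpansive_compact_convex_fixed_point)
  show "T \<in> K \<rightarrow> K"
    using assms(4) by (simp add: perimetric_nonexpansive_on_def)
qed (use assms perimetric_nonexpansive_on_imp_nonexpansive in auto)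

end
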